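(* Let $X$ be a normed space with the Daugavet property. Then the dual space $X^*$, equipped with the dual norm, has no smooth points; that is, there is no $x^* \in X^* \setminus \{0\}$ at which the norm of $X^*$ is Gâteaux differentiable.
   Context: Normed spaces are over the real or complex scalars and are not assumed complete. A normed space $X$ has the Daugavet property if $\|\mathrm{Id} + T\| = 1 + \|T\|$ for every (bounded linear) rank-one operator $T \colon X \to X$. For a normed space $E$ with unit sphere $S_E$ and $x \in E \setminus \{0\}$, the norm of $E$ is Gâteaux differentiable at $x$ (equivalently, $x$ is called a smooth point of $E$) if $\lim_{t \to 0} \frac{\|x + t h\| + \|x - t h\| - 2\|x\|}{t} = 0$ (with $t$ real) for every $h \in S_E$. *)

theory Defs
  imports "HOL-Analysis.Analysis"
begin

text \<open>
  HOL-Analysis has no normed spaces over the complex numbers. A normed space over the scalar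
  field \<open>'k\<close> (used for \<open>'k = real\<close> and \<open>'k = complex\<close>) is therefore a
  real normed vector space together with a scalar multiplication by \<open>'k\<close> that extends
  the real one and for which the norm is absolutely homogeneous.
\<close>

locale normed_space = vector_space scl
  for scl :: "'k::real_normed_field \<Rightarrow> 'a::real_normed_vector \<Rightarrow> 'a" +
  assumes scale_of_real: "scl (of_real r) x = r *\<^sub>R x"
    and norm_scale: "norm (scl c x) = norm c * norm x"

lemma normed_space_scaleR: "normed_space ((*\<^sub>R) :: real \<Rightarrow> 'a::real_normed_vector \<Rightarrow> 'a)"
  by unfold_locales (simp_all add: algebra_simps)

text \<open>
  Elements of \<open>'a \<Rightarrow>\<^sub>L 'b\<close> are only real-linear, so linearity over \<open>'k\<close> is
  imposed separately. The operator norm does not depend on the choice of scalars.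
  A set whose dimension is 1 in the sense of \<open>vector_space.dim\<close> really is
  one-dimensional, since that function takes the value 0 on infinite-dimensional sets.
\<close>

definition rank_one ::
    "('k::real_normed_field \<Rightarrow> 'a::real_normed_vector \<Rightarrow> 'a) \<Rightarrow> ('a \<Rightarrow>\<^sub>L 'a) \<Rightarrow> bool" where
  "rank_one scl T \<longleftrightarrow>
     Vector_Spaces.linear scl scl (blinfun_apply T) \<and>
     vector_space.dim scl (range (blinfun_apply T)) = 1"

definition daugavet_property ::
    "('k::real_normed_field \<Rightarrow> 'a::real_normed_vector \<Rightarrow> 'a) \<Rightarrow> bool" where
  "daugavet_property scl \<longleftrightarrow>
     (\<forall>T. rank_one scl T \<longrightarrow> norm (id_blinfun + T) = 1 + norm T)"

text \<open>The dual norm is the operator norm of \<open>'a \<Rightarrow>\<^sub>L 'k\<close>, restricted to this subspace.\<close>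

definition dual_space ::
    "('k::real_normed_field \<Rightarrow> 'a::real_normed_vector \<Rightarrow> 'a) \<Rightarrow> ('a \<Rightarrow>\<^sub>L 'k) set" where
  "dual_space scl = {f. Vector_Spaces.linear scl (*) (blinfun_apply f)}"

text \<open>
  \<open>E\<close> is a linear subspace of the ambient type, regarded as a normed space
  in its own right: only directions in the unit sphere of \<open>E\<close> are considered.
\<close>

definition smooth_point :: "'b::real_normed_vector set \<Rightarrow> 'b \<Rightarrow> bool" where
  "smooth_point E x \<longleftrightarrow> x \<in> E \<and> x \<noteq> 0 \<and>
     (\<forall>h\<in>E. norm h = 1 \<longrightarrow>
        ((\<lambda>t::real. (norm (x + t *\<^sub>R h) + norm (x - t *\<^sub>R h) - 2 * norm x) / t) \<longlongrightarrow> 0) (at 0))"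

end

theory Submission imports Defs
begin

text \<open>
  Let \<open>f\<close> be a nonzero functional. By the Daugavet property every slice given by \<open>f\<close> contains,
  for each compact set \<open>K\<close>, a point that is almost \<open>\<ell>\<^sub>1\<close>-orthogonal
  to \<open>K\<close>. Choosing such points one after the other gives sequences \<open>x\<^sub>n\<close>, \<open>y\<^sub>n\<close> in the unit
  ball along which \<open>f\<close> tends to its norm, while the convex hull of all \<open>x\<^sub>n\<close> and
  \<open>- y\<^sub>n\<close> stays at distance at least \<open>1/2\<close> from 0. By Hahn--Banach a functional \<open>h\<close>
  satisfies \<open>h x\<^sub>n \<ge> 1/2\<close> and \<open>h y\<^sub>n \<le> - 1/2\<close>, so that
  \<open>\<parallel>f \<plusminus> t h\<parallel> \<ge> \<parallel>f\<parallel> + t/2\<close> for all \<open>t > 0\<close>: the norm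
  is not smooth at \<open>f\<close>. Over the complex numbers the argument is applied to real parts.
\<close>

section \<open>Sublinear functionals and Hahn--Banach separation\<close>

definition sublinear :: "('a::real_vector \<Rightarrow> real) \<Rightarrow> bool" where
  "sublinear q \<longleftrightarrow>
     (\<forall>x y. q (x + y) \<le> q x + q y) \<and> (\<forall>a x. 0 \<le> a \<longrightarrow> q (a *\<^sub>R x) = a * q x)"

lemma sublinear_add: "sublinear q \<Longrightarrow> q (x + y) \<le> q x + q y"
  by (simp add: sublinear_def)

lemma sublinear_scale: "sublinear q \<Longrightarrow> 0 \<le> a \<Longrightarrow> q (a *\<^sub>R x) = a * q x"
  by (simp add: sublinear_def)

lemma sublinear_zero: "sublinear q \<Longrightarrow> q 0 = 0"
  using sublinear_scale[of q 0 0] by simp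

lemma sublinear_minus: "sublinear q \<Longrightarrow> - q (- x) \<le> q x"
  using sublinear_add[of q x "- x"] by (simp add: sublinear_zero)

lemma sublinearI:
  assumes add: "\<And>x y. q (x + y) \<le> q x + q y" and zero: "q 0 = 0"
    and scale: "\<And>a x. 0 < a \<Longrightarrow> q (a *\<^sub>R x) \<le> a * q x"
  shows "sublinear q"
proof -
  have "q (a *\<^sub>R x) = a * q x" if "0 \<le> a" for a x
  proof (cases "a = 0")
    case False
    then have a: "0 < a" using that by simp
    have "q (inverse a *\<^sub>R (a *\<^sub>R x)) \<le> inverse a * q (a *\<^sub>R x)"
      by (rule scale) (use a in simp)
    then have "a * q x \<le> q (a *\<^sub>R x)"
      using a by (simp add: field_simps)
    with scale[OF a] show ?thesis by (meson order_antisym)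
  qed (use zero in simp)
  with add show ?thesis by (simp add: sublinear_def)
qed

lemma sublinear_norm: "sublinear norm"
  by (simp add: sublinear_def norm_triangle_ineq)

text \<open>The infimum of \<open>q (x + a *\<^sub>R u) - a * c\<close> over
  \<open>0 \<le> a\<close> and \<open>u \<in> C\<close> is the largest sublinear minorant of
  \<open>q\<close> with the last property: \<open>a = 0\<close> gives \<open>r x \<le> q x\<close>,
  and \<open>a = 1\<close> at \<open>- u\<close> gives \<open>- c\<close>. A linear \<open>h\<close>
  below \<open>r\<close> then satisfies \<open>c \<le> h u\<close> on \<open>C\<close>.\<close>

lemma sublinear_reduce:
  fixes C :: "'a::real_vector set"
  assumes q: "sublinear q" and C: "convex C" "C \<noteq> {}" and c: "\<And>u. u \<in> C \<Longrightarrow> c \<le> q u"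
  obtains r where "sublinear r" "\<And>x. r x \<le> q x" "\<And>u. u \<in> C \<Longrightarrow> r (- u) \<le> - c"
proof -
  define V where "V x = {q (x + a *\<^sub>R u) - a * c | a u. 0 \<le> a \<and> u \<in> C}" for x
  define r where "r x = Inf (V x)" for x
  \<comment> \<open>This bound is free of \<open>a\<close> and \<open>u\<close>, so each infimum is
    finite; the hypothesis \<open>c \<le> q u\<close> enters here.\<close>
  have lower: "- q (- x) \<le> q (x + a *\<^sub>R u) - a * c" if "0 \<le> a" "u \<in> C" for x a u
  proof -
    have "a * c \<le> q (a *\<^sub>R u)"
      using that by (simp add: sublinear_scale[OF q] c mult_left_mono)
    also have "\<dots> \<le> q (x + a *\<^sub>R u) + q (- x)"
      using sublinear_add[OF q, of "x + a *\<^sub>R u" "- x"] by simp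
    finally show ?thesis by simp
  qed
  have bdd: "bdd_below (V x)" for x
    by (rule bdd_belowI[of _ "- q (- x)"]) (auto simp: V_def lower)
  have le: "r x \<le> q (x + a *\<^sub>R u) - a * c" if "0 \<le> a" "u \<in> C" for x a u
    unfolding r_def by (rule cInf_lower[OF _ bdd]) (use that in \<open>auto simp: V_def\<close>)
  have ge: "l \<le> r x" if "\<And>a u. 0 \<le> a \<Longrightarrow> u \<in> C \<Longrightarrow> l \<le> q (x + a *\<^sub>R u) - a * c" for l x
    unfolding r_def
  proof (rule cInf_greatest)
    show "V x \<noteq> {}" using C(2) unfolding V_def by blast
  qed (use that in \<open>auto simp: V_def\<close>)
  have rq: "r x \<le> q x" for x
    using C(2) le[of 0 _ x] by auto
  have "sublinear r"
  proof (rule sublinearI)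
    show "r 0 = 0"
    proof (rule antisym)
      show "r 0 \<le> 0" using rq[of 0] by (simp add: sublinear_zero[OF q])
      show "0 \<le> r 0" using lower[of _ _ 0] by (intro ge) (simp add: sublinear_zero[OF q])
    qed
  next
    fix a :: real and x assume a: "0 < a"
    have "r (a *\<^sub>R x) / a \<le> r x"
    proof (rule ge)
      fix b :: real and u assume b: "0 \<le> b" "u \<in> C"
      have "r (a *\<^sub>R x) \<le> q (a *\<^sub>R x + (a * b) *\<^sub>R u) - (a * b) * c"
        by (rule le) (use a b in auto)
      also have "\<dots> = a * (q (x + b *\<^sub>R u) - b * c)"
        using a sublinear_scale[OF q, of a "x + b *\<^sub>R u"] by (simp add: algebra_simps)
      finally show "r (a *\<^sub>R x) / a \<le> q (x + b *\<^sub>R u) - b * c"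
        using a by (simp add: field_simps)
    qed
    then show "r (a *\<^sub>R x) \<le> a * r x" using a by (simp add: field_simps)
  next
    fix x y
    have *: "r (x + y) \<le> (q (x + a *\<^sub>R u) - a * c) + (q (y + b *\<^sub>R v) - b * c)"
      if ab: "0 \<le> a" "u \<in> C" "0 \<le> b" "v \<in> C" for a b u v
    proof -
      \<comment> \<open>Convexity merges both competitors into one: the cone over \<open>C\<close>
        is closed under addition. If both weights vanish, any point of \<open>C\<close>
        serves.\<close>
      obtain w where w: "w \<in> C" "(a + b) *\<^sub>R w = a *\<^sub>R u + b *\<^sub>R v"
      proof (cases "a + b = 0")
        case True
        then have "a = 0" "b = 0" using ab by auto
        then show ?thesis using ab by (intro that[of u]) auto
      next
        case False
        then have "(a / (a + b)) *\<^sub>R u + (b / (a + b)) *\<^sub>R v \<in> C"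
          using ab by (intro convexD[OF C(1)]) (auto simp: add_divide_distrib[symmetric])
        then show ?thesis
          using False by (intro that) (auto simp: scaleR_right_distrib)
      qed
      have "r (x + y) \<le> q (x + y + (a + b) *\<^sub>R w) - (a + b) * c"
        by (rule le) (use that w in auto)
      also have "x + y + (a + b) *\<^sub>R w = (x + a *\<^sub>R u) + (y + b *\<^sub>R v)"
        by (simp add: w(2))
      also have "q \<dots> \<le> q (x + a *\<^sub>R u) + q (y + b *\<^sub>R v)"
        by (rule sublinear_add[OF q])
      finally show ?thesis by (simp add: algebra_simps)
    qed
    have "r (x + y) - (q (x + a *\<^sub>R u) - a * c) \<le> r y" if "0 \<le> a" "u \<in> C" for a u
      by (rule ge) (use *[of a u] that in \<open>force simp: algebra_simps\<close>)
    then have "r (x + y) - r y \<le> r x"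
      by (intro ge) (force simp: algebra_simps)
    then show "r (x + y) \<le> r x + r y" by simp
  qed
  moreover have "r (- u) \<le> - c" if "u \<in> C" for u
    using le[of 1 u "- u"] that by (simp add: sublinear_zero[OF q])
  ultimately show ?thesis using that rq by blast
qed

text \<open>Supplies the lower bounds for Zorn's lemma. The pointwise infimum is finite because
  \<open>- p (- x) \<le> - q (- x) \<le> q x\<close>; it is subadditive because the smaller of two
  members of the chain can be used for both summands.\<close>

lemma sublinear_Inf_chain:
  assumes ne: "A \<noteq> {}" and sub: "\<And>q. q \<in> A \<Longrightarrow> sublinear q"
    and chain: "\<And>q r. q \<in> A \<Longrightarrow> r \<in> A \<Longrightarrow> q \<le> r \<or> r \<le> q"
    and le: "\<And>q. q \<in> A \<Longrightarrow> q \<le> p"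
  obtains r where "sublinear r" "\<And>q. q \<in> A \<Longrightarrow> r \<le> q"
proof -
  define r where "r x = (INF q\<in>A. q x)" for x
  have bdd: "bdd_below ((\<lambda>q. q x) ` A)" for x
  proof (rule bdd_belowI2)
    fix q assume "q \<in> A"
    then show "- p (- x) \<le> q x"
      using sublinear_minus[OF sub, of q x] le_funD[OF le, of q "- x"] by simp
  qed
  have lower: "r x \<le> q x" if "q \<in> A" for q x
    unfolding r_def by (rule cINF_lower[OF bdd that])
  have greatest: "l \<le> r x" if "\<And>q. q \<in> A \<Longrightarrow> l \<le> q x" for l x
    unfolding r_def by (rule cINF_greatest[OF ne that])
  have "sublinear r"
  proof (rule sublinearI)
    show "r 0 = 0"
      using ne by (simp add: r_def sublinear_zero[OF sub])
  next
    fix a :: real and x assume a: "0 < a"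
    have "r (a *\<^sub>R x) / a \<le> r x"
    proof (rule greatest)
      fix q assume "q \<in> A"
      then show "r (a *\<^sub>R x) / a \<le> q x"
        using lower[of q "a *\<^sub>R x"] a sublinear_scale[OF sub, of q a x] by (simp add: field_simps)
    qed
    then show "r (a *\<^sub>R x) \<le> a * r x" using a by (simp add: field_simps)
  next
    fix x y
    have *: "r (x + y) \<le> q x + s y" if qs: "q \<in> A" "s \<in> A" for q s
      using chain[OF qs]
    proof
      assume "q \<le> s"
      then show ?thesis
        using lower[of q "x + y"] sublinear_add[OF sub, of q x y] qs le_funD[of q s y] by simp
    next
      assume "s \<le> q"
      then show ?thesis
        using lower[of s "x + y"] sublinear_add[OF sub, of s x y] qs le_funD[of s q x] by simp
    qed
    have "r (x + y) - q x \<le> r y" if "q \<in> A" for q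
      by (rule greatest) (use *[of q] that in \<open>force simp: algebra_simps\<close>)
    then have "r (x + y) - r y \<le> r x"
      by (intro greatest) (force simp: algebra_simps)
    then show "r (x + y) \<le> r x + r y" by simp
  qed
  then show ?thesis using lower that by (force simp: le_fun_def)
qed

text \<open>A minimal sublinear functional is linear: otherwise reducing it at a single point
  \<open>y\<close> would give a smaller one.\<close>

lemma sublinear_dominates_linear:
  fixes p :: "'a::real_vector \<Rightarrow> real"
  assumes p: "sublinear p"
  obtains h where "linear h" "\<And>x. h x \<le> p x"
proof -
  define S where "S = {q. sublinear q \<and> q \<le> p}"
  \<comment> \<open>Zorn with the order reversed, so that a maximal element is a minimal
    functional.\<close>
  have "\<exists>m\<in>S. \<forall>q\<in>S. q \<le> m \<longrightarrow> q = m"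
  proof (rule predicate_Zorn[where P = "\<lambda>q r. r \<le> q"])
    show "partial_order_on S (relation_of (\<lambda>q r. r \<le> q) S)"
      by (rule partial_order_on_relation_ofI) auto
  next
    fix A assume "A \<in> Chains (relation_of (\<lambda>q r. r \<le> q) S)"
    then have A: "A \<subseteq> S" "\<And>q r. q \<in> A \<Longrightarrow> r \<in> A \<Longrightarrow> q \<le> r \<or> r \<le> q"
      by (auto simp: Chains_def relation_of_def)
    show "\<exists>u\<in>S. \<forall>a\<in>A. u \<le> a"
    proof (cases "A = {}")
      case True
      then show ?thesis using p by (auto simp: S_def)
    next
      case False
      then obtain r where r: "sublinear r" "\<And>q. q \<in> A \<Longrightarrow> r \<le> q"
        using A by (elim sublinear_Inf_chain[of A p]) (auto simp: S_def)
      moreover have "r \<in> S"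
        using r False A(1) unfolding S_def by (blast intro: order_trans)
      ultimately show ?thesis by blast
    qed
  qed
  then obtain h where h: "sublinear h" "h \<le> p" and min: "\<And>q. q \<in> S \<Longrightarrow> q \<le> h \<Longrightarrow> q = h"
    by (auto simp: S_def)
  have minus: "h (- y) = - h y" for y
  proof -
    obtain r where r: "sublinear r" "\<And>x. r x \<le> h x" "r (- y) \<le> - h y"
      by (rule sublinear_reduce[OF h(1), of "{y}" "h y"]) auto
    have "r \<le> h" using r(2) by (rule le_funI)
    then have "r = h"
      using r(1) order_trans[OF _ h(2)] by (intro min) (auto simp: S_def)
    then show ?thesis
      using r sublinear_minus[OF h(1), of y] by simp
  qed
  have add: "h (x + y) = h x + h y" for x y
    using sublinear_add[OF h(1), of x y] sublinear_add[OF h(1), of "x + y" "- y"]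
    by (simp add: minus)
  have "h (a *\<^sub>R x) = a * h x" for a x
    using sublinear_scale[OF h(1), of a x] sublinear_scale[OF h(1), of "- a" x] minus[of "a *\<^sub>R x"]
    by (cases "0 \<le> a") auto
  then have "linear h"
    by (intro linearI) (auto simp: add)
  then show ?thesis using that h by (auto simp: le_fun_def)
qed

text \<open>Hahn-Banach for the norm reduced along \<open>C\<close>: that \<open>h\<close> lies
  below \<open>r\<close>, and \<open>r\<close> below the norm, bounds \<open>h\<close>, and
  \<open>r (- u) \<le> - c\<close> gives the separation. A singleton \<open>C\<close> produces
  norming functionals.\<close>

lemma separating_functional:
  fixes C :: "'a::real_normed_vector set"
  assumes C: "convex C" "C \<noteq> {}" and c: "\<And>u. u \<in> C \<Longrightarrow> c \<le> norm u"
  obtains h :: "'a \<Rightarrow>\<^sub>L real" where "norm h \<le> 1" "\<And>u. u \<in> C \<Longrightarrow> c \<le> h u"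
proof -
  obtain r where r: "sublinear r" "\<And>x. r x \<le> norm x" "\<And>u. u \<in> C \<Longrightarrow> r (- u) \<le> - c"
    using sublinear_reduce[OF sublinear_norm C c] by blast
  obtain h where h: "linear h" "\<And>x. h x \<le> r x"
    using sublinear_dominates_linear[OF r(1)] by blast
  have minus: "h (- x) = - h x" for x
    using h(1) by (rule linear_neg)
  have bound: "\<bar>h x\<bar> \<le> norm x" for x
    using h(2)[of x] r(2)[of x] h(2)[of "- x"] r(2)[of "- x"] by (simp add: minus)
  have bl: "bounded_linear h"
    using h(1) bound by (intro bounded_linear_intro[of _ 1]) (auto simp: linear_add linear_cmul)
  have "c \<le> h u" if "u \<in> C" for u
    using h(2)[of "- u"] r(3)[OF that] by (simp add: minus)
  then show ?thesis
    using bound by (intro that[of "Blinfun h"] norm_blinfun_bound)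
      (simp_all add: bounded_linear_Blinfun_apply[OF bl])
qed

section \<open>Slices of the unit ball\<close>

text \<open>The depth \<open>e\<close> is measured down from \<open>norm f\<close> and
  \<open>f\<close> is not normalised; for \<open>f = 0\<close> and \<open>0 < e\<close> this is the
  whole unit ball.\<close>

definition slice :: "('a::real_normed_vector \<Rightarrow>\<^sub>L real) \<Rightarrow> real \<Rightarrow> 'a set" where
  "slice f e = {x. norm x \<le> 1 \<and> norm f - e < f x}"

text \<open>The condition by which slices characterise the Daugavet property, for real functionals.
  It depends on the type alone and not on \<open>scl\<close>, so real and complex spaces share
  everything built on it.\<close>

definition daugavet_slices :: "'a::real_normed_vector itself \<Rightarrow> bool" where
  "daugavet_slices _ \<longleftrightarrow>
     (\<forall>(f :: 'a \<Rightarrow>\<^sub>L real) x e. norm x = 1 \<longrightarrow> 0 < e \<longrightarrow> (\<exists>z\<in>slice f e. 2 - e < norm (x + z)))"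

lemma blinfun_norm_attained:
  fixes f :: "'a::real_normed_vector \<Rightarrow>\<^sub>L 'b::real_normed_vector"
  assumes "0 < e"
  obtains x where "norm x \<le> 1" "norm f - e < norm (f x)"
proof -
  have "\<exists>x. norm x \<le> 1 \<and> norm f - e < norm (f x)"
  proof (rule ccontr)
    assume "\<not> ?thesis"
    then have small: "norm (f x) \<le> norm f - e" if "norm x \<le> 1" for x
      using that by force
    have "norm f \<le> norm f - e"
    proof (rule norm_blinfun_bound)
      show "0 \<le> norm f - e" using small[of 0] by simp
      fix x
      show "norm (f x) \<le> (norm f - e) * norm x"
      proof (cases "x = 0")
        case False
        have "norm (f (x /\<^sub>R norm x)) \<le> norm f - e"
          using False by (intro small) simp
        then show ?thesis
          using False by (simp add: blinfun.scaleR_right field_simps)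
      qed simp
    qed
    then show False using assms by simp
  qed
  then show ?thesis using that by blast
qed

lemma slice_nonempty:
  assumes "0 < e"
  obtains x where "x \<in> slice f e"
proof -
  obtain x where x: "norm x \<le> 1" "norm f - e < norm (f x)"
    using blinfun_norm_attained[OF assms] .
  show ?thesis
  proof (cases "0 \<le> f x")
    case True
    then show ?thesis using x by (intro that[of x]) (simp add: slice_def)
  next
    case False
    then show ?thesis using x by (intro that[of "- x"]) (simp add: slice_def blinfun.minus_right)
  qed
qed

lemma blinfun_le_norm:
  fixes f :: "'a::real_normed_vector \<Rightarrow>\<^sub>L real"
  assumes "norm f \<le> m" "norm x \<le> 1" shows "f x \<le> m"
proof -
  have "f x \<le> norm f * norm x" using norm_blinfun[of f x] by simp
  also have "\<dots> \<le> m * 1" using assms by (intro mult_mono) (auto intro: order_trans[OF norm_ge_zero])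
  finally show ?thesis by simp
qed

text \<open>A functional \<open>y\<close> norming \<open>x + z\<close> is almost 1 at \<open>x\<close> and at \<open>z\<close>; a point where
  \<open>f + y\<close> almost attains its norm therefore almost peaks both \<open>f\<close> and \<open>y\<close>.\<close>

lemma subslice_unit:
  fixes f :: "'a::real_normed_vector \<Rightarrow>\<^sub>L real"
  assumes X: "daugavet_slices TYPE('a)" and x: "norm x = 1" and e: "0 < e"
  obtains g d where "0 < d" "slice g d \<subseteq> slice f e"
    "\<And>w a b. w \<in> slice g d \<Longrightarrow> 0 \<le> a \<Longrightarrow> 0 \<le> b \<Longrightarrow> (1 - e) * (a + b) \<le> norm (a *\<^sub>R x + b *\<^sub>R w)"
proof -
  \<comment> \<open>Three losses of \<open>d\<close> add up to \<open>e\<close>: at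
    \<open>f z\<close>, at \<open>y z\<close>, and from the depth of the slice of
    \<open>f + y\<close>.\<close>
  define d where "d = e / 3"
  have d: "0 < d" using e by (simp add: d_def)
  obtain z where z: "norm z \<le> 1" "norm f - d < f z" "2 - d < norm (x + z)"
    using X x d unfolding daugavet_slices_def slice_def by blast
  obtain y :: "'a \<Rightarrow>\<^sub>L real" where y: "norm y \<le> 1" "norm (x + z) \<le> y (x + z)"
    by (rule separating_functional[of "{x + z}" "norm (x + z)"]) auto
  have yx: "1 - d < y x" and yz: "1 - d < y z"
    using y(2) z(3) blinfun_le_norm[OF y(1) z(1)] blinfun_le_norm[OF y(1), of x] x
    by (auto simp: blinfun.add_right)
  have "norm f + 1 - 2 * d < (f + y) z"
    using z(2) yz by (simp add: blinfun.add_left)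
  also have "\<dots> \<le> norm (f + y)"
    by (rule blinfun_le_norm[OF order_refl z(1)])
  finally have big: "norm f + 1 - 2 * d < norm (f + y)" .
  have w: "norm f - e < f w" "1 - e < y w" "norm w \<le> 1" if "w \<in> slice (f + y) d" for w
    using that big blinfun_le_norm[OF order_refl, of w f] blinfun_le_norm[OF y(1), of w]
    by (auto simp: slice_def blinfun.add_left d_def)
  have *: "(1 - e) * (a + b) \<le> norm (a *\<^sub>R x + b *\<^sub>R w)"
    if "w \<in> slice (f + y) d" "0 \<le> a" "0 \<le> b" for w a b
  proof -
    have "(1 - e) * (a + b) = a * (1 - e) + b * (1 - e)" by (simp add: algebra_simps)
    also have "\<dots> \<le> a * y x + b * y w"
      using that w[OF that(1)] yx d by (intro add_mono mult_left_mono) (auto simp: d_def)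
    also have "\<dots> = y (a *\<^sub>R x + b *\<^sub>R w)" by (simp add: blinfun.add_right blinfun.scaleR_right)
    also have "\<dots> \<le> norm y * norm (a *\<^sub>R x + b *\<^sub>R w)"
      using norm_blinfun[of y "a *\<^sub>R x + b *\<^sub>R w"] by simp
    also have "\<dots> \<le> norm (a *\<^sub>R x + b *\<^sub>R w)"
      using y(1) by (simp add: mult_left_le_one_le)
    finally show ?thesis .
  qed
  have "slice (f + y) d \<subseteq> slice f e"
    using w(1,3) unfolding slice_def[of f] by blast
  then show ?thesis by (rule that[OF d _ *])
qed

text \<open>Each new vector shrinks the slice by \<open>subslice_unit\<close>; the estimates gained
  before hold for all \<open>w\<close> in the old slice and so survive. They say that
  \<open>w\<close> is almost l1-orthogonal to each \<open>u\<close>.\<close>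

lemma subslice_finite:
  fixes f :: "'a::real_normed_vector \<Rightarrow>\<^sub>L real"
  assumes X: "daugavet_slices TYPE('a)" and "finite N" "0 \<notin> N" and e: "0 < e"
  shows "\<exists>g d. 0 < d \<and> slice g d \<subseteq> slice f e \<and> (\<forall>w\<in>slice g d. \<forall>u\<in>N. \<forall>a\<ge>0. \<forall>b\<ge>0.
           (1 - e) * (a * norm u + b) \<le> norm (a *\<^sub>R u + b *\<^sub>R w))"
  using assms(2,3)
proof (induction N rule: finite_induct)
  case empty
  then show ?case using e by auto
next
  case (insert u N)
  then obtain g d where g: "0 < d" "slice g d \<subseteq> slice f e"
    "\<And>w v a b. w \<in> slice g d \<Longrightarrow> v \<in> N \<Longrightarrow> 0 \<le> a \<Longrightarrow> 0 \<le> b \<Longrightarrow>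
       (1 - e) * (a * norm v + b) \<le> norm (a *\<^sub>R v + b *\<^sub>R w)"
    by auto
  have u: "u \<noteq> 0" using insert by auto
  \<comment> \<open>Bounded by \<open>d\<close> to stay inside the previous slice, by
    \<open>e\<close> to keep the factor \<open>1 - e\<close>.\<close>
  define e' where "e' = min d e"
  have e': "0 < e'" "e' \<le> e" using g(1) e by (auto simp: e'_def)
  have "norm (u /\<^sub>R norm u) = 1" using u by simp
  then obtain g' d' where g': "0 < d'" "slice g' d' \<subseteq> slice g e'"
    "\<And>w a b. w \<in> slice g' d' \<Longrightarrow> 0 \<le> a \<Longrightarrow> 0 \<le> b \<Longrightarrow>
       (1 - e') * (a + b) \<le> norm (a *\<^sub>R (u /\<^sub>R norm u) + b *\<^sub>R w)"
    by (rule subslice_unit[OF X _ e'(1), of _ g]) (rule that; blast)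
  have sub: "slice g' d' \<subseteq> slice g d"
    using g'(2) by (force simp: slice_def e'_def)
  have "(1 - e) * (a * norm v + b) \<le> norm (a *\<^sub>R v + b *\<^sub>R w)"
    if "w \<in> slice g' d'" "v \<in> insert u N" "0 \<le> a" "0 \<le> b" for w v a b
  proof (cases "v = u")
    case True
    have "(1 - e) * (a * norm u + b) \<le> (1 - e') * (a * norm u + b)"
      using e' that by (intro mult_right_mono) auto
    also have "\<dots> \<le> norm ((a * norm u) *\<^sub>R (u /\<^sub>R norm u) + b *\<^sub>R w)"
      using that by (intro g'(3)) auto
    also have "(a * norm u) *\<^sub>R (u /\<^sub>R norm u) = a *\<^sub>R u"
      using u by (simp flip: divide_inverse)
    finally show ?thesis using True by simp
  next
    case False
    then show ?thesis using that sub g(3) by auto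
  qed
  then show ?case using g'(1) sub g(2) by (intro exI[of _ g'] exI[of _ d']) auto
qed

text \<open>Since the norm attains its minimum on \<open>K\<close>, there is a margin above
  \<open>c\<close> that absorbs both the passage to a finite net and the factor in
  \<open>subslice_finite\<close>.\<close>

lemma slice_avoiding_compact:
  fixes f :: "'a::real_normed_vector \<Rightarrow>\<^sub>L real"
  assumes X: "daugavet_slices TYPE('a)" and K: "compact K" "K \<noteq> {}"
    and c: "0 < c" "c < 1" "\<And>u. u \<in> K \<Longrightarrow> c < norm u" and e: "0 < e"
  obtains w where "w \<in> slice f e"
    "\<And>u a b. u \<in> K \<Longrightarrow> 0 \<le> a \<Longrightarrow> 0 \<le> b \<Longrightarrow> a + b = 1 \<Longrightarrow> c < norm (a *\<^sub>R u + b *\<^sub>R w)"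
proof -
  obtain u0 where u0: "u0 \<in> K" "\<And>u. u \<in> K \<Longrightarrow> norm u0 \<le> norm u"
    using continuous_attains_inf[OF K continuous_on_norm[OF continuous_on_id]] by auto
  \<comment> \<open>The cap at 1 gives \<open>b * m \<le> b\<close> for the coefficient of
    \<open>w\<close>; \<open>c < m\<close> combines \<open>c < 1\<close> with the attained
    minimum.\<close>
  define m where "m = min 1 (norm u0)"
  have m: "c < m" "m \<le> 1" "\<And>u. u \<in> K \<Longrightarrow> m \<le> norm u"
    using u0 c by (auto simp: m_def min_le_iff_disj)
  \<comment> \<open>The factor \<open>1 - d\<close> costs \<open>d * m \<le> d\<close> and the net
    at most \<open>d\<close>, so the norm stays above \<open>m - 3 * d \<ge> c\<close>.\<close>
  define d where "d = min e ((m - c) / 3)"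
  have d: "0 < d" "d \<le> e" "3 * d \<le> m - c" using m e by (auto simp: d_def min_def field_simps)
  obtain N where N: "finite N" "N \<subseteq> K" "K \<subseteq> (\<Union>u\<in>N. ball u d)"
    using compactE_image[OF K(1), of K "\<lambda>u. ball u d"] d
    by (metis (no_types, lifting) UN_I centre_in_ball open_ball subsetI)
  have "0 \<notin> N" using N(2) c by force
  then obtain g d' where g: "0 < d'" "slice g d' \<subseteq> slice f d"
    "\<And>w u a b. w \<in> slice g d' \<Longrightarrow> u \<in> N \<Longrightarrow> 0 \<le> a \<Longrightarrow> 0 \<le> b \<Longrightarrow>
       (1 - d) * (a * norm u + b) \<le> norm (a *\<^sub>R u + b *\<^sub>R w)"
    using subslice_finite[OF X N(1) _ d(1), of f] by blast
  obtain w where w: "w \<in> slice g d'" using slice_nonempty[OF g(1)] .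
  have "c < norm (a *\<^sub>R u + b *\<^sub>R w)" if u: "u \<in> K" and ab: "0 \<le> a" "0 \<le> b" "a + b = 1" for u a b
  proof -
    obtain v where v: "v \<in> N" "norm (v - u) < d"
      using N(3) u by (auto simp: dist_norm)
    have "m = a * m + b * m" using ab(3) by (metis distrib_right mult_1)
    also have "\<dots> \<le> a * norm v + b"
      using m v N(2) ab mult_left_mono[of m 1 b] by (intro add_mono mult_left_mono) auto
    finally have "(1 - d) * m \<le> (1 - d) * (a * norm v + b)"
      using d m c by (intro mult_left_mono) auto
    also have "\<dots> \<le> norm (a *\<^sub>R v + b *\<^sub>R w)"
      by (rule g(3)[OF w v(1) ab(1,2)])
    also have "a *\<^sub>R v + b *\<^sub>R w = (a *\<^sub>R u + b *\<^sub>R w) + a *\<^sub>R (v - u)"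
      by (simp add: algebra_simps)
    also have "norm \<dots> \<le> norm (a *\<^sub>R u + b *\<^sub>R w) + a * norm (v - u)"
      using norm_triangle_ineq[of "a *\<^sub>R u + b *\<^sub>R w" "a *\<^sub>R (v - u)"] ab by simp
    also have "a * norm (v - u) \<le> 1 * d"
      using ab v d by (intro mult_mono) auto
    finally have "m - d * m - d \<le> norm (a *\<^sub>R u + b *\<^sub>R w)" by (simp add: algebra_simps)
    moreover have "d * m \<le> d" using d m by simp
    ultimately show ?thesis using d(1,3) by linarith
  qed
  moreover have "w \<in> slice f e"
    using w g(2) d(2) by (force simp: slice_def)
  ultimately show ?thesis using that by blast
qed

text \<open>A finite set has a compact hull, and adding \<open>w\<close> fills in exactly the
  segments from \<open>w\<close> to that hull. The strict bound \<open>c\<close> is kept, so the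
  step can be iterated without loss.\<close>

lemma convex_hull_insert_slice:
  fixes f :: "'a::real_normed_vector \<Rightarrow>\<^sub>L real"
  assumes X: "daugavet_slices TYPE('a)" and F: "finite F" "F \<noteq> {}"
    and c: "0 < c" "c < 1" "\<And>u. u \<in> convex hull F \<Longrightarrow> c < norm u" and e: "0 < e"
  obtains w where "w \<in> slice f e" "\<And>u. u \<in> convex hull (insert w F) \<Longrightarrow> c < norm u"
proof -
  obtain w where w: "w \<in> slice f e"
    "\<And>u a b. u \<in> convex hull F \<Longrightarrow> 0 \<le> a \<Longrightarrow> 0 \<le> b \<Longrightarrow> a + b = 1 \<Longrightarrow> c < norm (a *\<^sub>R u + b *\<^sub>R w)"
    using slice_avoiding_compact[OF X finite_imp_compact_convex_hull[OF F(1)] _ c e] F(2)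
    by (metis convex_hull_eq_empty)
  have "c < norm u" if "u \<in> convex hull (insert w F)" for u
  proof -
    have "\<exists>a\<ge>0. \<exists>b\<ge>0. \<exists>v. a + b = 1 \<and> v \<in> convex hull F \<and> u = a *\<^sub>R w + b *\<^sub>R v"
      using that by (simp add: convex_hull_insert[OF F(2)])
    then obtain a b v where "0 \<le> a" "0 \<le> b" "a + b = 1" "v \<in> convex hull F" "u = a *\<^sub>R w + b *\<^sub>R v"
      by blast
    then show ?thesis using w(2)[of v b a] by (simp add: add.commute)
  qed
  then show ?thesis using that w(1) by blast
qed

text \<open>The directions \<open>h\<close> and \<open>- h\<close> both increase the norm at a rate
  of at least 1/2: a corner of the dual norm. The sets \<open>F n\<close> are kept finite because
  the inductive step relies on the compactness of their hulls.\<close>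

lemma oscillating_functional:
  fixes f :: "'a::real_normed_vector \<Rightarrow>\<^sub>L real"
  assumes X: "daugavet_slices TYPE('a)" and f: "f \<noteq> 0"
  obtains h :: "'a \<Rightarrow>\<^sub>L real" where
    "\<And>t. 0 < t \<Longrightarrow> norm f + t / 2 \<le> norm (f + t *\<^sub>R h)"
    "\<And>t. 0 < t \<Longrightarrow> norm f + t / 2 \<le> norm (f - t *\<^sub>R h)"
proof -
  define P where "P F \<longleftrightarrow> finite F \<and> F \<noteq> {} \<and> (\<forall>u\<in>convex hull F. 1/2 < norm u)" for F :: "'a set"
  define Q where "Q n F G \<longleftrightarrow> F \<subseteq> G \<and>
     (\<exists>x\<in>slice f (1 / real (Suc n)). \<exists>y\<in>slice f (1 / real (Suc n)). {x, - y} \<subseteq> G)"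
    for n and F G :: "'a set"
  have "\<exists>F :: nat \<Rightarrow> 'a set. \<forall>n. P (F n) \<and> Q n (F n) (F (Suc n))"
  proof (rule dependent_nat_choice)
    \<comment> \<open>\<open>f \<noteq> 0\<close> provides a nonzero vector; normalised, it is a
      starting set at distance 1 from 0.\<close>
    obtain v where "f v \<noteq> 0" using f by (metis blinfun_eqI zero_blinfun.rep_eq)
    then have "v \<noteq> 0" by auto
    then have "P {v /\<^sub>R norm v}" by (auto simp: P_def)
    then show "\<exists>F. P F" ..
  next
    fix F :: "'a set" and n assume F: "P F"
    define e where "e = 1 / real (Suc n)"
    have e: "0 < e" by (simp add: e_def)
    obtain x where x: "x \<in> slice f e" "\<And>u. u \<in> convex hull (insert x F) \<Longrightarrow> 1/2 < norm u"
      using convex_hull_insert_slice[OF X, of F "1/2" e f] F e unfolding P_def by auto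
    \<comment> \<open>Drawing \<open>y\<close> from the slice of \<open>- f\<close> makes
      \<open>- y\<close> the second slice point required by \<open>Q\<close>, whose negative is
      \<open>y\<close> itself.\<close>
    obtain y where y: "y \<in> slice (- f) e"
      "\<And>u. u \<in> convex hull (insert y (insert x F)) \<Longrightarrow> 1/2 < norm u"
      using convex_hull_insert_slice[OF X, of "insert x F" "1/2" e "- f"] F x(2) e
      unfolding P_def by auto
    have "- y \<in> slice f e"
      using y(1) by (simp add: slice_def blinfun.minus_right blinfun.minus_left)
    then have "Q n F (insert y (insert x F))"
      unfolding Q_def e_def[symmetric] using x(1) by force
    moreover have "P (insert y (insert x F))"
      using F y(2) by (simp add: P_def)
    ultimately show "\<exists>G. P G \<and> Q n F G" by blast
  qed
  then obtain F :: "nat \<Rightarrow> 'a set" where P: "\<And>n. P (F n)" and Q: "\<And>n. Q n (F n) (F (Suc n))"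
    by blast
  define C where "C = (\<Union>n. convex hull (F n))"
  have mono: "convex hull (F m) \<subseteq> convex hull (F n)" if "m \<le> n" for m n
    by (rule lift_Suc_mono_le[OF _ that]) (use Q in \<open>auto simp: Q_def intro!: hull_mono\<close>)
  have "convex C"
  proof (rule convexI)
    fix x y and a b :: real assume xy: "x \<in> C" "y \<in> C" and ab: "0 \<le> a" "0 \<le> b" "a + b = 1"
    obtain m n where "x \<in> convex hull (F m)" "y \<in> convex hull (F n)"
      using xy by (auto simp: C_def)
    then have "x \<in> convex hull (F (max m n))" "y \<in> convex hull (F (max m n))"
      using mono[of m "max m n"] mono[of n "max m n"] by auto
    then have "a *\<^sub>R x + b *\<^sub>R y \<in> convex hull (F (max m n))"
      using ab by (intro convexD[OF convex_convex_hull])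
    then show "a *\<^sub>R x + b *\<^sub>R y \<in> C" by (auto simp: C_def)
  qed
  have "C \<noteq> {}" using P by (auto simp: C_def P_def)
  obtain h :: "'a \<Rightarrow>\<^sub>L real" where h: "\<And>u. u \<in> C \<Longrightarrow> 1/2 \<le> h u"
    using separating_functional[OF \<open>convex C\<close> \<open>C \<noteq> {}\<close>, of "1/2"] P
    unfolding C_def P_def by (metis UN_E less_eq_real_def)
  have osc: "\<exists>x\<in>slice f e. \<exists>y\<in>slice f e. 1/2 \<le> h x \<and> h y \<le> - (1/2)" if e: "0 < e" for e
  proof -
    obtain n where n: "1 / real (Suc n) < e" using nat_approx_posE[OF e] by auto
    obtain x y where xy: "x \<in> slice f (1 / real (Suc n))" "y \<in> slice f (1 / real (Suc n))"
      "{x, - y} \<subseteq> F (Suc n)"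
      using Q[of n] unfolding Q_def by blast
    have "x \<in> C" "- y \<in> C"
      using xy(3) hull_subset[of "F (Suc n)" convex] by (auto simp: C_def)
    then have "1/2 \<le> h x" "h y \<le> - (1/2)"
      using h[of x] h[of "- y"] by (auto simp: blinfun.minus_right)
    moreover have "slice f (1 / real (Suc n)) \<subseteq> slice f e"
      using n by (auto simp: slice_def)
    ultimately show ?thesis using xy by blast
  qed
  \<comment> \<open>\<open>f + t *\<^sub>R h\<close> is tested at \<open>x\<close> and
    \<open>f - t *\<^sub>R h\<close> at \<open>y\<close>, where both terms are large; the slack
    \<open>e\<close> is the depth of the slice.\<close>
  have "norm f + t / 2 \<le> norm (f + t *\<^sub>R h) \<and> norm f + t / 2 \<le> norm (f - t *\<^sub>R h)"
    if t: "0 < t" for t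
  proof (intro conjI; rule field_le_epsilon)
    fix e :: real assume "0 < e"
    then obtain x y where x: "x \<in> slice f e" "1/2 \<le> h x" and y: "y \<in> slice f e" "h y \<le> - (1/2)"
      using osc by blast
    have "t * (1/2) \<le> t * h x" "t * h y \<le> t * - (1/2)"
      by (rule mult_left_mono; use t x y in simp)+
    then show "norm f + t / 2 \<le> norm (f + t *\<^sub>R h) + e" "norm f + t / 2 \<le> norm (f - t *\<^sub>R h) + e"
      using x y blinfun_le_norm[OF order_refl, of x "f + t *\<^sub>R h"]
        blinfun_le_norm[OF order_refl, of y "f - t *\<^sub>R h"]
      by (auto simp: slice_def blinfun.add_left blinfun.diff_left blinfun.scaleR_left)
  qed
  then show ?thesis using that by blast
qed

section \<open>From the Daugavet property to slices\<close>

context normed_space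
begin

lemma dual_spaceD:
  assumes "f \<in> dual_space scl"
  shows "blinfun_apply f (scl c x) = c * blinfun_apply f x"
  using assms by (simp add: dual_space_def Vector_Spaces.linear_iff)

lemma dual_spaceI:
  assumes "\<And>c x. blinfun_apply f (scl c x) = c * blinfun_apply f x"
  shows "f \<in> dual_space scl"
proof -
  have "vector_space ((*) :: 'k \<Rightarrow> 'k \<Rightarrow> 'k)" by unfold_locales (auto simp: algebra_simps)
  then show ?thesis
    using assms vector_space_axioms by (simp add: dual_space_def Vector_Spaces.linear_iff blinfun.add_right)
qed

lemma dual_space_scaleR: "f \<in> dual_space scl \<Longrightarrow> r *\<^sub>R f \<in> dual_space scl"
  by (rule dual_spaceI) (simp add: dual_spaceD blinfun.scaleR_left)

lemma dual_space_add: "f \<in> dual_space scl \<Longrightarrow> g \<in> dual_space scl \<Longrightarrow> f + g \<in> dual_space scl"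
  by (rule dual_spaceI) (simp add: dual_spaceD blinfun.add_left distrib_left)

lemma exists_rotation:
  assumes "f \<in> dual_space scl"
  obtains c where "norm c = 1" "blinfun_apply f (scl c z) = of_real (norm (blinfun_apply f z))"
proof (cases "blinfun_apply f z = 0")
  case True
  then show ?thesis using assms by (intro that[of 1]) (auto simp: dual_spaceD)
next
  case False
  then show ?thesis
    using assms by (intro that[of "of_real (norm (blinfun_apply f z)) / blinfun_apply f z"])
      (auto simp: dual_spaceD norm_divide)
qed

text \<open>The operator \<open>T z = scl (f z) x\<close> has rank one and norm 1, so
  \<open>id_blinfun + T\<close> has norm 2 and nearly attains it.\<close>

lemma daugavet_rank_one:
  assumes D: "daugavet_property scl" and f: "f \<in> dual_space scl" "norm f = 1" and x: "norm x = 1"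
    and e: "0 < e"
  obtains z where "norm z \<le> 1" "2 - e < norm (z + scl (blinfun_apply f z) x)"
proof -
  define T where "T = Blinfun (\<lambda>z. scl (blinfun_apply f z) x)"
  have "bounded_linear (\<lambda>z. scl (blinfun_apply f z) x)"
  proof (rule bounded_linear_intro)
    fix r y
    have "scl (blinfun_apply f (r *\<^sub>R y)) x = scl (of_real r) (scl (blinfun_apply f y) x)"
      by (simp add: blinfun.scaleR_right scaleR_conv_of_real)
    then show "scl (blinfun_apply f (r *\<^sub>R y)) x = r *\<^sub>R scl (blinfun_apply f y) x"
      by (simp only: scale_of_real)
    show "norm (scl (blinfun_apply f y) x) \<le> norm y * 1"
      using norm_blinfun[of f y] f(2) x by (simp add: norm_scale)
  qed (simp add: blinfun.add_right scale_left_distrib)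
  then have T: "blinfun_apply T z = scl (blinfun_apply f z) x" for z
    by (simp add: T_def bounded_linear_Blinfun_apply)
  have normT: "norm T = 1"
  proof (rule antisym)
    show "norm T \<le> 1"
      using norm_blinfun[of f] f(2) x by (intro norm_blinfun_bound) (auto simp: T norm_scale)
    have "norm f \<le> norm T"
      using norm_blinfun[of T] x by (intro norm_blinfun_bound) (auto simp: T norm_scale)
    then show "1 \<le> norm T" using f(2) by simp
  qed
  \<comment> \<open>\<open>f\<close> is nonzero and homogeneous, so it takes every scalar value and
    the range is the whole line of \<open>x\<close>.\<close>
  have "range (blinfun_apply T) = span {x}"
  proof
    show "range (blinfun_apply T) \<subseteq> span {x}" by (auto simp: T span_singleton)
    obtain v where v: "blinfun_apply f v \<noteq> 0"
      using f(2) by (metis blinfun_eqI zero_blinfun.rep_eq norm_zero zero_neq_one)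
    have "scl k x = blinfun_apply T (scl (k / blinfun_apply f v) v)" for k
      using v by (simp add: T dual_spaceD[OF f(1)])
    then show "span {x} \<subseteq> range (blinfun_apply T)" by (auto simp: span_singleton)
  qed
  moreover have "independent {x}"
    using x by (auto simp: dependent_single)
  ultimately have "dim (range (blinfun_apply T)) = 1"
    by (simp add: dim_eq_card_independent)
  then have "rank_one scl T"
    using vector_space_axioms unfolding rank_one_def Vector_Spaces.linear_iff
    by (auto simp: T blinfun.add_right dual_spaceD[OF f(1)] scale_left_distrib)
  then have "norm (id_blinfun + T) = 2"
    using D normT by (simp add: daugavet_property_def)
  then show ?thesis
    using blinfun_norm_attained[OF e, of "id_blinfun + T"] that by (auto simp: T blinfun.add_left)
qed

text \<open>A norm near 2 forces \<open>norm (f y)\<close> to be near 1. Rotating by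
  \<open>c\<close> turns \<open>f y\<close> into the real number \<open>r\<close> and the vector
  into \<open>scl c y + r *\<^sub>R x\<close>; replacing \<open>r *\<^sub>R x\<close> by
  \<open>x\<close> costs \<open>1 - r\<close>. As \<open>f z\<close> is real, the real part of
  \<open>f\<close> takes the same value at \<open>z\<close>.\<close>

lemma daugavet_slice_unit:
  assumes D: "daugavet_property scl" and f: "f \<in> dual_space scl" "norm f = 1" and x: "norm x = 1"
    and e: "0 < e"
  obtains z r where "norm z \<le> 1" "blinfun_apply f z = of_real r" "1 - e < r" "2 - e < norm (x + z)"
proof -
  \<comment> \<open>Half of \<open>e\<close> covers the defect of the norm, the other half the cost
    \<open>1 - r\<close>.\<close>
  obtain y where y: "norm y \<le> 1" "2 - e / 2 < norm (y + scl (blinfun_apply f y) x)"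
    using daugavet_rank_one[OF D f x, of "e / 2"] e by auto
  define r where "r = norm (blinfun_apply f y)"
  have r: "r \<le> 1" using norm_blinfun[of f y] f(2) y(1) by (simp add: r_def)
  have "norm (y + scl (blinfun_apply f y) x) \<le> 1 + r"
    using norm_triangle_ineq[of y "scl (blinfun_apply f y) x"] y(1) x by (simp add: norm_scale r_def)
  then have r': "1 - e / 2 < r" using y(2) by simp
  obtain c where c: "norm c = 1" "blinfun_apply f (scl c y) = of_real r"
    using exists_rotation[OF f(1)] unfolding r_def by blast
  have "scl c (y + scl (blinfun_apply f y) x) = scl c y + scl (of_real r) x"
    using c(2) by (simp add: scale_right_distrib dual_spaceD[OF f(1)])
  also have "\<dots> = (x + scl c y) - (1 - r) *\<^sub>R x"
    by (simp add: scale_of_real algebra_simps)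
  finally have "norm (y + scl (blinfun_apply f y) x) = norm ((x + scl c y) - (1 - r) *\<^sub>R x)"
    using c(1) by (metis norm_scale mult_1)
  also have "\<dots> \<le> norm (x + scl c y) + (1 - r)"
    using norm_triangle_ineq4[of "x + scl c y" "(1 - r) *\<^sub>R x"] r x by simp
  finally have "2 - e < norm (x + scl c y)" using y(2) r' by simp
  then show ?thesis
    using that[of "scl c y" r] c y(1) r' e by (simp add: norm_scale)
qed

end

text \<open>Dividing by \<open>norm f\<close> reduces to unit functionals; for \<open>f = 0\<close>
  the slice is the ball and \<open>z = x\<close> works.\<close>

lemma daugavet_slicesI:
  assumes unit: "\<And>(f :: 'a::real_normed_vector \<Rightarrow>\<^sub>L real) x e. norm f = 1 \<Longrightarrow> norm x = 1 \<Longrightarrow> 0 < e \<Longrightarrow>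
    \<exists>z. norm z \<le> 1 \<and> 1 - e < blinfun_apply f z \<and> 2 - e < norm (x + z)"
  shows "daugavet_slices TYPE('a)"
  unfolding daugavet_slices_def
proof (intro allI impI)
  fix f :: "'a \<Rightarrow>\<^sub>L real" and x :: 'a and e :: real assume x: "norm x = 1" and e: "0 < e"
  show "\<exists>z\<in>slice f e. 2 - e < norm (x + z)"
  proof (cases "f = 0")
    case True
    have "norm (x + x) = 2" using x by (simp add: scaleR_2[symmetric])
    then show ?thesis using True x e by (intro bexI[of _ x]) (auto simp: slice_def)
  next
    case False
    \<comment> \<open>The first bound keeps the norm estimate, the second the slice depth after
      multiplication by \<open>norm f\<close>.\<close>
    define d where "d = min e (e / norm f)"
    have d: "0 < d" "d \<le> e" "d * norm f \<le> e"
      using e False by (auto simp: d_def min_def field_simps)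
    obtain z where z: "norm z \<le> 1" "1 - d < (f /\<^sub>R norm f) z" "2 - d < norm (x + z)"
      using unit[of "f /\<^sub>R norm f" x d] False x d by auto
    have "norm f - d * norm f < f z"
      using z(2) False by (simp add: blinfun.scaleR_left field_simps)
    then show ?thesis using z d by (intro bexI[of _ z]) (auto simp: slice_def)
  qed
qed

section \<open>Complex functionals and their real parts\<close>

text \<open>A rotation of \<open>x\<close> makes \<open>g\<close> real and nonnegative there without
  changing \<open>norm x\<close>, so the real part already sees the full modulus.\<close>

lemma norm_dual_space_Re:
  fixes scl :: "complex \<Rightarrow> 'a::real_normed_vector \<Rightarrow> 'a" and f :: "'a \<Rightarrow>\<^sub>L real"
  assumes "normed_space scl" and g: "g \<in> dual_space scl" and f: "\<And>x. f x = Re (blinfun_apply g x)"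
  shows "norm g = norm f"
proof (rule antisym)
  interpret normed_space scl by fact
  show "norm g \<le> norm f"
  proof (rule norm_blinfun_bound)
    fix x
    obtain c where c: "norm c = 1" "blinfun_apply g (scl c x) = of_real (norm (blinfun_apply g x))"
      using exists_rotation[OF g] .
    have "norm (blinfun_apply g x) = f (scl c x)" using c(2) by (simp add: f)
    also have "\<dots> \<le> norm f * norm (scl c x)" using norm_blinfun[of f "scl c x"] by simp
    finally show "norm (blinfun_apply g x) \<le> norm f * norm x" using c(1) by (simp add: norm_scale)
  qed simp
  show "norm f \<le> norm g"
    using norm_blinfun[of g] abs_Re_le_cmod by (intro norm_blinfun_bound) (auto simp: f intro: order_trans)
qed

text \<open>The functional \<open>f x - \<i> * f (scl \<i> x)\<close> commutes with multiplication
  by \<open>\<i>\<close>. Together with \<open>norm_dual_space_Re\<close>, taking real parts is an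
  isometry of the complex dual onto the real one.\<close>

lemma dual_space_of_Re:
  fixes scl :: "complex \<Rightarrow> 'a::real_normed_vector \<Rightarrow> 'a" and f :: "'a \<Rightarrow>\<^sub>L real"
  assumes "normed_space scl"
  obtains g where "g \<in> dual_space scl" "\<And>x. f x = Re (blinfun_apply g x)"
proof -
  interpret normed_space scl by fact
  have scaleR: "r *\<^sub>R x = scl (of_real r) x" for r x by (simp add: scale_of_real)
  have "bounded_linear (scl \<i>)"
    by (rule bounded_linear_intro[of _ 1])
      (simp_all add: scale_right_distrib norm_scale scaleR mult.commute)
  then have "bounded_linear (\<lambda>x. of_real (f x) - \<i> * of_real (f (scl \<i> x)))"
    by (intro bounded_linear_sub bounded_linear_const_mult bounded_linear_compose[OF bounded_linear_of_real]
        bounded_linear_compose[OF blinfun.bounded_linear_right] blinfun.bounded_linear_right)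
  define g where "g = Blinfun (\<lambda>x. of_real (f x) - \<i> * of_real (f (scl \<i> x)))"
  have g: "blinfun_apply g x = of_real (f x) - \<i> * of_real (f (scl \<i> x))" for x
    unfolding g_def by (simp add: bounded_linear_Blinfun_apply[OF \<open>bounded_linear (\<lambda>x. of_real _ - _)\<close>])
  show ?thesis
  proof (rule that)
    show "g \<in> dual_space scl"
    proof (rule dual_spaceI)
      fix c x
      have "scl c x = Re c *\<^sub>R x + Im c *\<^sub>R scl \<i> x"
        by (simp add: scaleR scale_left_distrib[symmetric] complex_eq mult.commute flip: complex_eq)
      moreover have "scl \<i> (scl c x) = Re c *\<^sub>R scl \<i> x - Im c *\<^sub>R x"
      proof -
        have "\<i> * c = of_real (Re c) * \<i> - of_real (Im c)" by (simp add: complex_eq_iff)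
        then show ?thesis by (simp add: scaleR scale_left_diff_distrib)
      qed
      ultimately have "f (scl c x) = Re c * f x + Im c * f (scl \<i> x)"
        "f (scl \<i> (scl c x)) = Re c * f (scl \<i> x) - Im c * f x"
        by (simp_all add: blinfun.add_right blinfun.diff_right blinfun.scaleR_right)
      then show "blinfun_apply g (scl c x) = c * blinfun_apply g x"
        by (simp only: g) (simp add: complex_eq_iff algebra_simps)
    qed
  qed (simp add: g)
qed

section \<open>Smooth points\<close>

text \<open>The two one-sided gains of \<open>t / 2\<close> add up, so for positive \<open>s\<close>
  the difference quotient in the normalised direction is at least \<open>1 / norm h\<close> and
  cannot tend to 0.\<close>

lemma not_smooth_point:
  assumes h: "\<And>r. r *\<^sub>R h \<in> E" and t: "\<And>t. 0 < t \<Longrightarrow> norm f + t / 2 \<le> norm (f + t *\<^sub>R h)"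
    "\<And>t. 0 < t \<Longrightarrow> norm f + t / 2 \<le> norm (f - t *\<^sub>R h)"
  shows "\<not> smooth_point E f"
proof
  assume smooth: "smooth_point E f"
  have "h \<noteq> 0" using t(1)[of 1] by auto
  define g where "g = h /\<^sub>R norm h"
  define q where "q s = (norm (f + s *\<^sub>R g) + norm (f - s *\<^sub>R g) - 2 * norm f) / s" for s
  have "g \<in> E" "norm g = 1" using h \<open>h \<noteq> 0\<close> by (auto simp: g_def)
  then have "(q \<longlongrightarrow> 0) (at 0)"
    using smooth unfolding smooth_point_def q_def by blast
  \<comment> \<open>The quotient is odd in \<open>s\<close>, so the lower bound concerns positive
    \<open>s\<close> only.\<close>
  then have "(q \<longlongrightarrow> 0) (at_right 0)"
    by (rule tendsto_mono[OF at_le, rotated]) simp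
  moreover have "1 / norm h \<le> q s" if s: "0 < s" for s
  proof -
    have "(s / norm h) *\<^sub>R h = s *\<^sub>R g" by (simp add: g_def divide_inverse)
    then have "s / norm h \<le> norm (f + s *\<^sub>R g) + norm (f - s *\<^sub>R g) - 2 * norm f"
      using t[of "s / norm h"] s \<open>h \<noteq> 0\<close> by simp
    then show ?thesis using s by (simp add: q_def pos_le_divide_eq)
  qed
  then have "eventually (\<lambda>s. 1 / norm h \<le> q s) (at_right 0)"
    by (intro eventually_mono[OF eventually_at_right_less])
  ultimately have "1 / norm h \<le> 0" by (rule tendsto_lowerbound) simp
  then show False using \<open>h \<noteq> 0\<close> by simp
qed

lemma real_dual_not_smooth:
  assumes "daugavet_property ((*\<^sub>R) :: real \<Rightarrow> 'a::real_normed_vector \<Rightarrow> 'a)"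
  shows "\<not> smooth_point (dual_space ((*\<^sub>R) :: real \<Rightarrow> 'a \<Rightarrow> 'a)) f"
proof
  assume smooth: "smooth_point (dual_space ((*\<^sub>R) :: real \<Rightarrow> 'a \<Rightarrow> 'a)) f"
  interpret S: normed_space "(*\<^sub>R) :: real \<Rightarrow> 'a \<Rightarrow> 'a" by (rule normed_space_scaleR)
  have dual: "g \<in> dual_space ((*\<^sub>R) :: real \<Rightarrow> 'a \<Rightarrow> 'a)" for g
    by (rule S.dual_spaceI) (simp add: blinfun.scaleR_right)
  have X: "daugavet_slices TYPE('a)"
  proof (rule daugavet_slicesI)
    fix g :: "'a \<Rightarrow>\<^sub>L real" and x :: 'a and e :: real
    assume "norm g = 1" "norm x = 1" "0 < e"
    then obtain z r where "norm z \<le> 1" "blinfun_apply g z = of_real r" "1 - e < r" "2 - e < norm (x + z)"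
      by (rule S.daugavet_slice_unit[OF assms dual])
    then show "\<exists>z. norm z \<le> 1 \<and> 1 - e < g z \<and> 2 - e < norm (x + z)" by auto
  qed
  have "f \<noteq> 0" using smooth by (simp add: smooth_point_def)
  then obtain h where "\<And>t. 0 < t \<Longrightarrow> norm f + t / 2 \<le> norm (f + t *\<^sub>R h)"
    "\<And>t. 0 < t \<Longrightarrow> norm f + t / 2 \<le> norm (f - t *\<^sub>R h)"
    using oscillating_functional[OF X] by blast
  from not_smooth_point[OF dual this] smooth show False by blast
qed

lemma complex_dual_not_smooth:
  fixes scl :: "complex \<Rightarrow> 'a::real_normed_vector \<Rightarrow> 'a"
  assumes scl: "normed_space scl" and D: "daugavet_property scl"
  shows "\<not> smooth_point (dual_space scl) f"
proof
  assume smooth: "smooth_point (dual_space scl) f"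
  interpret normed_space scl by fact
  have X: "daugavet_slices TYPE('a)"
  proof (rule daugavet_slicesI)
    fix g :: "'a \<Rightarrow>\<^sub>L real" and x :: 'a and e :: real
    assume g: "norm g = 1" and x: "norm x = 1" and e: "0 < e"
    \<comment> \<open>The complex estimate applies to the extension \<open>G\<close>, and a real
      value \<open>r\<close> of \<open>G\<close> at \<open>z\<close> is also the value of
      \<open>g\<close>.\<close>
    obtain G where G: "G \<in> dual_space scl" "\<And>x. g x = Re (blinfun_apply G x)"
      using dual_space_of_Re[OF scl, of g] by blast
    have "norm G = 1" using norm_dual_space_Re[OF scl G] g by simp
    then obtain z r where "norm z \<le> 1" "blinfun_apply G z = of_real r" "1 - e < r" "2 - e < norm (x + z)"
      by (rule daugavet_slice_unit[OF D G(1) _ x e])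
    then show "\<exists>z. norm z \<le> 1 \<and> 1 - e < g z \<and> 2 - e < norm (x + z)" by (auto simp: G(2))
  qed
  have f: "f \<in> dual_space scl" "f \<noteq> 0" using smooth by (auto simp: smooth_point_def)
  define g where "g = Blinfun (\<lambda>x. Re (blinfun_apply f x))"
  have g: "g x = Re (blinfun_apply f x)" for x
    unfolding g_def
    by (simp add: bounded_linear_Blinfun_apply bounded_linear_compose[OF bounded_linear_Re blinfun.bounded_linear_right])
  have fg: "norm f = norm g" by (rule norm_dual_space_Re[OF scl f(1) g])
  then have "g \<noteq> 0" using f(2) by auto
  then obtain h where h: "\<And>t. 0 < t \<Longrightarrow> norm g + t / 2 \<le> norm (g + t *\<^sub>R h)"
    "\<And>t. 0 < t \<Longrightarrow> norm g + t / 2 \<le> norm (g - t *\<^sub>R h)"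
    using oscillating_functional[OF X] by blast
  obtain H where H: "H \<in> dual_space scl" "\<And>x. h x = Re (blinfun_apply H x)"
    using dual_space_of_Re[OF scl, of h] by blast
  \<comment> \<open>\<open>g + t *\<^sub>R h\<close> is the real part of
    \<open>f + t *\<^sub>R H\<close>, so the norms agree along the whole line; \<open>- t\<close>
    handles the difference.\<close>
  have eq: "norm (f + t *\<^sub>R H) = norm (g + t *\<^sub>R h)" for t
    by (rule norm_dual_space_Re[OF scl dual_space_add[OF f(1) dual_space_scaleR[OF H(1)]]])
      (simp add: blinfun.add_left blinfun.scaleR_left g H(2))
  have "\<not> smooth_point (dual_space scl) f"
  proof (rule not_smooth_point)
    show "r *\<^sub>R H \<in> dual_space scl" for r using H(1) by (rule dual_space_scaleR)
    show "norm f + t / 2 \<le> norm (f + t *\<^sub>R H)" "norm f + t / 2 \<le> norm (f - t *\<^sub>R H)"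
      if "0 < t" for t
      using h[OF that] eq[of t] eq[of "- t"] fg by simp_all
  qed
  then show False using smooth by simp
qed

theorem theorem2p1:
  shows "(daugavet_property ((*\<^sub>R) :: real \<Rightarrow> 'a::real_normed_vector \<Rightarrow> 'a) \<longrightarrow>
            \<not> (\<exists>f. smooth_point (dual_space ((*\<^sub>R) :: real \<Rightarrow> 'a \<Rightarrow> 'a)) f)) \<and>
         (\<forall>scl :: complex \<Rightarrow> 'b::real_normed_vector \<Rightarrow> 'b.
            normed_space scl \<longrightarrow> daugavet_property scl \<longrightarrow>
            \<not> (\<exists>f. smooth_point (dual_space scl) f))"
  using real_dual_not_smooth complex_dual_not_smooth by blast

end
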